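(* Let $\xi$ be an extremal number with conjugates $\xi'$ and $\xi''$, and let $(\alpha_i)_{i\ge i_0}$ be the associated sequence of best quadratic approximations to $\xi$ (constructed as in the context from a sequence $(\mathbf x_i)_{i\ge1}$ and a matrix $M$ attached to $\xi$). For each $i\geq i_0$, let $\bar\alpha_i$ denote the conjugate of $\alpha_i$ over $\mathbb Q$. Then, as $i\to\infty$, we have \[|\xi'-\bar\alpha_{2i-1}|\asymp H(\alpha_{2i-1})^{-2}\quad\text{and}\quad|\xi''-\bar\alpha_{2i}|\asymp H(\alpha_{2i})^{-2}.\] Therefore, the sequence of conjugates of a sequence of best quadratic approximations to $\xi$ admits exactly two accumulation points, namely the conjugates $\xi'$ and $\xi''$ of $\xi$.
   Context: Let $\gamma=(1+\sqrt5)/2$. A real number $\xi$ is \emph{extremal} if it is neither rational nor quadratic over $\mathbb Q$ and there is a constant $c>0$ such that, for each real $X\ge 1$, the inequalities $|x_0|\le X$, $|x_0\xi-x_1|\le cX^{-1/\gamma}$, $|x_0\xi^2-x_2|\le cX^{-1/\gamma}$ admit a non-zero solution $(x_0,x_1,x_2)\in\mathbb Z^3$. $A\asymp B$ means $c_1B\le A\le c_2B$ with constants $c_1,c_2>0$ independent of $i$. The norm of a real matrix, vector or polynomial is the largest absolute value of its coefficients. The height $H(\alpha)$ of an algebraic number $\alpha$ is the norm of its minimal polynomial in $\mathbb Z[T]$ (with relatively prime coefficients). Let $\mathcal P$ be the set of $2\times2$ integer matrices with non-zero determinant and relatively prime coefficients; it is a group under $\mathbf y_1*\mathbf y_2=c^{-1}\mathbf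 y_1\mathbf y_2$, where $c$ is the greatest positive common divisor of the coefficients of $\mathbf y_1\mathbf y_2$. It is known that for each extremal $\xi$ there is an unbounded sequence $(\mathbf x_i)_{i\ge1}$ of symmetric matrices in $\mathcal P$ with $\|\mathbf x_{i+1}\|\asymp\|\mathbf x_i\|^\gamma$, $\|(\xi,-1)\mathbf x_i\|\asymp\|\mathbf x_i\|^{-1}$ and $|\det\mathbf x_i|\asymp1$, and a matrix $M=\begin{pmatrix}a&b\\c&d\end{pmatrix}\in\mathcal P$, neither symmetric nor skew-symmetric, such that $\mathbf x_{i+2}=\pm\,\mathbf x_{i+1}*M*\mathbf x_i$ if $i$ is odd and $\mathbf x_{i+2}=\pm\,\mathbf x_{i+1}*{}^tM*\mathbf x_i$ if $i$ is even; this holds for all large $i$ and, without loss of generality, is assumed for each $i\ge1$. Fix such data. The \emph{conjugates} of $\xi$ are $\xi'=-\frac{a+b\xi}{c+d\xi}$ and $\xi''=-\frac{a+c\xi}{b+d\xi}$; the set $\{\xi',\xi''\}$ depends only on $\xi$. Put $J=\begin{pmatrix}0&1\\-1&0\end{pmatrix}$, $M_i=M$ if $i$ is even, $M_i={}^tM$ if $i$ is odd, $W_i=\mathbf x_i*M_i$, and $F_i(U,T)=-\begin{pmatrix}U&T\end{pmatrix}JW_i\begin{pmatrix}U\\ T\end{pmatrix}\in\mathbb Z[U,T]$. There is an integer $i_0\ge1$ such that, for each $i\ge i_0$, $F_i$ is irreducible over $\mathbb Q$ and the root $\alpha_i$ of $F_i(1,T)$ closest to $\xi$ is algebraic of degree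 $2$ over $\mathbb Q$, with $H(\alpha_i)\asymp\|F_i\|\asymp\|\mathbf x_i\|$ and $|\xi-\alpha_i|\asymp H(\alpha_i)^{-2\gamma-2}$, while $|\xi-\alpha|\ge c' H(\alpha)^{-4}$, with a constant $c'>0$ independent of $\alpha$, for each algebraic $\alpha\in\mathbb C$ of degree $\le2$ not in $\{\alpha_i\,;\,i\ge i_0\}$. The sequence $(\alpha_i)_{i\ge i_0}$ is uniquely determined by $\xi$ up to its first terms and is called a sequence of \emph{best quadratic approximations} to $\xi$. *)

theory Defs
  imports "HOL-Analysis.Analysis" "HOL-Computational_Algebra.Polynomial"
begin

definition golden :: real where
  "golden = (1 + sqrt 5) / 2"

definition comparable_on :: "nat set \<Rightarrow> (nat \<Rightarrow> real) \<Rightarrow> (nat \<Rightarrow> real) \<Rightarrow> bool" where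
  "comparable_on I A B \<longleftrightarrow>
     (\<exists>c1>0. \<exists>c2>0. \<forall>i\<in>I. c1 * B i \<le> A i \<and> A i \<le> c2 * B i)"


(* Relatively prime coefficients determine the minimal polynomial only up to sign;
   the sign is fixed by a positive leading coefficient.  The value is meaningful
   only for algebraic arguments; the same holds for alg_degree and height. *)
definition min_int_poly :: "'a::field_char_0 \<Rightarrow> int poly" where
  "min_int_poly \<alpha> = (THE p.
     content p = 1 \<and> lead_coeff p > 0 \<and> poly (map_poly of_int p) \<alpha> = 0 \<and>
     (\<forall>q::int poly. q \<noteq> 0 \<and> poly (map_poly of_int q) \<alpha> = 0 \<longrightarrow> degree p \<le> degree q))"

definition alg_degree :: "'a::field_char_0 \<Rightarrow> nat" where
  "alg_degree \<alpha> = degree (min_int_poly \<alpha>)"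

definition height :: "'a::field_char_0 \<Rightarrow> real" where
  "height \<alpha> = real_of_int (Max (range (\<lambda>k. \<bar>coeff (min_int_poly \<alpha>) k\<bar>)))"

(* The conjugate over the rationals of a number of degree 2. *)
definition quadratic_conjugate :: "complex \<Rightarrow> complex" where
  "quadratic_conjugate \<alpha> =
     (THE \<beta>. \<beta> \<noteq> \<alpha> \<and> poly (map_poly of_int (min_int_poly \<alpha>)) \<beta> = 0)"


definition extremal :: "real \<Rightarrow> bool" where
  "extremal \<xi> \<longleftrightarrow>
     \<xi> \<notin> \<rat> \<and> \<not> (algebraic \<xi> \<and> alg_degree \<xi> = 2) \<and>
     (\<exists>c>0. \<forall>X\<ge>1. \<exists>x0 x1 x2 :: int. (x0, x1, x2) \<noteq> (0, 0, 0) \<and>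
        \<bar>real_of_int x0\<bar> \<le> X \<and>
        \<bar>of_int x0 * \<xi> - of_int x1\<bar> \<le> c * X powr (- 1 / golden) \<and>
        \<bar>of_int x0 * \<xi>\<^sup>2 - of_int x2\<bar> \<le> c * X powr (- 1 / golden))"


definition entries_gcd :: "int^2^2 \<Rightarrow> int" where
  "entries_gcd A = Gcd {A $ i $ j | i j. True}"

definition primitive_matrices :: "(int^2^2) set" where
  "primitive_matrices = {A. det A \<noteq> 0 \<and> entries_gcd A = 1}"

definition prim_mult :: "int^2^2 \<Rightarrow> int^2^2 \<Rightarrow> int^2^2" (infixl "\<star>" 70) where
  "A \<star> B = (\<chi> i j. (A ** B) $ i $ j div entries_gcd (A ** B))"

(* infnorm on real^2 and on real^2^2 is the largest absolute value of the coefficients. *)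
definition matrix_norm :: "int^2^2 \<Rightarrow> real" where
  "matrix_norm A = infnorm (map_matrix of_int A :: real^2^2)"

definition extremal_data :: "real \<Rightarrow> (nat \<Rightarrow> int^2^2) \<Rightarrow> int^2^2 \<Rightarrow> bool" where
  "extremal_data \<xi> x M \<longleftrightarrow>
     (\<forall>i\<ge>1. x i \<in> primitive_matrices \<and> transpose (x i) = x i) \<and>
     \<not> bounded ((\<lambda>i. map_matrix of_int (x i) :: real^2^2) ` {1..}) \<and>
     comparable_on {1..} (\<lambda>i. matrix_norm (x (i + 1))) (\<lambda>i. matrix_norm (x i) powr golden) \<and>
     comparable_on {1..} (\<lambda>i. infnorm (vector [\<xi>, - 1] v* (map_matrix of_int (x i) :: real^2^2)))
                    (\<lambda>i. matrix_norm (x i) powr (- 1)) \<and>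
     comparable_on {1..} (\<lambda>i. \<bar>real_of_int (det (x i))\<bar>) (\<lambda>i. 1) \<and>
     M \<in> primitive_matrices \<and> transpose M \<noteq> M \<and> transpose M \<noteq> - M \<and>
     (\<forall>i\<ge>1. odd i \<longrightarrow>
        x (i + 2) = x (i + 1) \<star> M \<star> x i \<or> x (i + 2) = - (x (i + 1) \<star> M \<star> x i)) \<and>
     (\<forall>i\<ge>1. even i \<longrightarrow>
        x (i + 2) = x (i + 1) \<star> transpose M \<star> x i \<or>
        x (i + 2) = - (x (i + 1) \<star> transpose M \<star> x i))"

(* With M = (a, b; c, d), conjugate1 is xi' and conjugate2, the same expression for the
   transpose of M, is xi''. *)
definition conjugate1 :: "real \<Rightarrow> int^2^2 \<Rightarrow> real" where
  "conjugate1 \<xi> M =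
     - (of_int (M $ 1 $ 1) + of_int (M $ 1 $ 2) * \<xi>) / (of_int (M $ 2 $ 1) + of_int (M $ 2 $ 2) * \<xi>)"

definition conjugate2 :: "real \<Rightarrow> int^2^2 \<Rightarrow> real" where
  "conjugate2 \<xi> M =
     - (of_int (M $ 1 $ 1) + of_int (M $ 2 $ 1) * \<xi>) / (of_int (M $ 1 $ 2) + of_int (M $ 2 $ 2) * \<xi>)"


definition Jmat :: "int^2^2" where
  "Jmat = vector [vector [0, 1], vector [- 1, 0]]"

definition Wmat :: "(nat \<Rightarrow> int^2^2) \<Rightarrow> int^2^2 \<Rightarrow> nat \<Rightarrow> int^2^2" where
  "Wmat x M i = x i \<star> (if even i then M else transpose M)"

(* Z[U,T] is represented as Z[U][T]: the outer indeterminate is T, the inner one is U. *)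
definition UTvec :: "(int poly poly)^2" where
  "UTvec = vector [[:[:0, 1:]:], [:0, 1:]]"

definition Fform :: "(nat \<Rightarrow> int^2^2) \<Rightarrow> int^2^2 \<Rightarrow> nat \<Rightarrow> int poly poly" where
  "Fform x M i =
     - (\<Sum>k\<in>UNIV. (UTvec v* map_matrix of_int (Jmat ** Wmat x M i)) $ k * UTvec $ k)"

definition bipoly_norm :: "int poly poly \<Rightarrow> real" where
  "bipoly_norm P = real_of_int (Max {\<bar>coeff (coeff P j) k\<bar> | j k. True})"

definition irreducible_over_rat :: "int poly poly \<Rightarrow> bool" where
  "irreducible_over_rat P \<longleftrightarrow> irreducible (map_poly (map_poly rat_of_int) P)"

definition at_U_eq_1 :: "int poly poly \<Rightarrow> int poly" where
  "at_U_eq_1 P = map_poly (\<lambda>q. poly q 1) P"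

definition best_quadratic_approximations ::
  "real \<Rightarrow> (nat \<Rightarrow> int^2^2) \<Rightarrow> int^2^2 \<Rightarrow> nat \<Rightarrow> (nat \<Rightarrow> complex) \<Rightarrow> bool" where
  "best_quadratic_approximations \<xi> x M i0 \<alpha> \<longleftrightarrow>
     i0 \<ge> 1 \<and>
     (\<forall>i\<ge>i0. irreducible_over_rat (Fform x M i) \<and>
        is_arg_min (\<lambda>\<beta>. cmod (of_real \<xi> - \<beta>))
          (\<lambda>\<beta>. poly (map_poly of_int (at_U_eq_1 (Fform x M i))) \<beta> = 0) (\<alpha> i) \<and>
        algebraic (\<alpha> i) \<and> alg_degree (\<alpha> i) = 2) \<and>
     comparable_on {i0..} (\<lambda>i. height (\<alpha> i)) (\<lambda>i. bipoly_norm (Fform x M i)) \<and>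
     comparable_on {i0..} (\<lambda>i. bipoly_norm (Fform x M i)) (\<lambda>i. matrix_norm (x i)) \<and>
     comparable_on {i0..} (\<lambda>i. cmod (of_real \<xi> - \<alpha> i))
                     (\<lambda>i. height (\<alpha> i) powr (- 2 * golden - 2)) \<and>
     (\<exists>c'>0. \<forall>\<beta>::complex. algebraic \<beta> \<and> alg_degree \<beta> \<le> 2 \<and> \<beta> \<notin> \<alpha> ` {i0..} \<longrightarrow>
        cmod (of_real \<xi> - \<beta>) \<ge> c' * height \<beta> powr (- 4))"


(* Accumulation points of a sequence (not of its range): every neighbourhood
   contains terms of arbitrarily large index. *)
definition accumulation_points :: "(nat \<Rightarrow> 'a::topological_space) \<Rightarrow> 'a set" where
  "accumulation_points a =
     {z. \<forall>S. open S \<and> z \<in> S \<longrightarrow> (\<exists>\<^sub>F i in sequentially. a i \<in> S)}"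

end

theory Submission
  imports Defs "HOL-Library.Landau_Symbols"
begin

text \<open>
  Let \<open>N = (a, b; c, d)\<close> be the one of \<open>M\<close>, \<open>M\<^sup>T\<close> that occurs at the index \<open>i\<close>, let \<open>X\<close> be the norm of the
  symmetric matrix \<open>x\<^sub>i = (x0, x1; x1, x2)\<close>, and put \<open>(e1, e2) = (\<xi>, -1) x\<^sub>i\<close>, which has norm of order
  \<open>1/X\<close>. A positive integer multiple of \<open>F\<^sub>i(1,z)\<close> is
  \<open>(z, -1) x\<^sub>i N (1, z)\<^sup>T = (b x0 + d x1) (z - \<alpha>\<^sub>i) (z - \<beta>\<^sub>i)\<close>, with \<open>\<beta>\<^sub>i\<close> the conjugate of \<open>\<alpha>\<^sub>i\<close>
  (lemma \<open>best_approximation_factor\<close>). Since \<open>x1\<close> is close to \<open>\<xi> x0\<close>, the leading coefficient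
  has order \<open>X\<close>.

  Let \<open>t = - (a + c\<xi>) / (b + d\<xi>)\<close> and \<open>s = - (a + b\<xi>) / (c + d\<xi>)\<close> be the two conjugates of \<open>\<xi>\<close>. The vector
  \<open>N (1, t)\<^sup>T\<close> is orthogonal to \<open>(1, \<xi>)\<close>, hence a non-zero constant multiple of \<open>(\<xi>, -1)\<^sup>T\<close>, so the value
  at \<open>z = t\<close> is a constant multiple of \<open>t e1 - e2\<close>. This is of order at most \<open>1/X\<close>, and the difficulty is
  to exclude cancellation. The value at \<open>z = \<xi>\<close> is a constant multiple of \<open>e2 - s e1\<close>, and it is \<open>o(1/X)\<close>
  because \<open>\<alpha>\<^sub>i\<close> is so close to \<open>\<xi>\<close>. Thus \<open>(e1, e2)\<close> is nearly proportional to \<open>(1, s)\<close>, and as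
  \<open>s \<noteq> t\<close> the quantity \<open>t e1 - e2\<close> has exact order \<open>1/X\<close>. Dividing by the leading coefficient and by
  \<open>t - \<alpha>\<^sub>i\<close>, which tends to \<open>t - \<xi> \<noteq> 0\<close>, shows that the distance from \<open>t\<close> to \<open>\<beta>\<^sub>i\<close> has
  order \<open>1/X\<^sup>2\<close>, that is \<open>H(\<alpha>\<^sub>i)\<^bsup>-2\<^esup>\<close> (lemma \<open>conjugate_root_asymptotics\<close>).

  The estimates hold for all large \<open>i\<close>. They extend to the finitely many other indices once the distance
  is known not to vanish there, which is lemma \<open>conjugate_not_attained\<close>. The accumulation points are then
  the limits along the odd and along the even indices.
\<close>

section \<open>Minimal polynomials and quadratic conjugates\<close>

lemma map_poly_of_int_diff:
  "map_poly of_int (p - q) = (map_poly of_int p - map_poly of_int q :: 'a::ring_1 poly)"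
  by (rule poly_eqI) (simp add: coeff_map_poly)

lemma map_poly_of_int_smult:
  "map_poly of_int (smult c p) = (smult (of_int c) (map_poly of_int p) :: 'a::comm_ring_1 poly)"
  by (rule poly_eqI) (simp add: coeff_map_poly)

text \<open>Integer polynomials of minimal degree with a given root agree up to constant factors: the
  combination of the two that cancels the leading terms has smaller degree, so it vanishes.\<close>

lemma minimal_int_poly_proportional:
  fixes \<alpha> :: "'a::field_char_0" and p q :: "int poly"
  assumes p: "poly (map_poly of_int p) \<alpha> = 0"
    and q: "poly (map_poly of_int q) \<alpha> = 0" "degree q \<le> degree p"
    and min: "\<And>r::int poly. r \<noteq> 0 \<Longrightarrow> poly (map_poly of_int r) \<alpha> = 0 \<Longrightarrow> degree p \<le> degree r"
  shows "smult (lead_coeff p) q = smult (coeff q (degree p)) p"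
proof (rule ccontr)
  define r where "r = smult (lead_coeff p) q - smult (coeff q (degree p)) p"
  assume "\<not> ?thesis"
  then have "r \<noteq> 0" by (simp add: r_def)
  moreover have "poly (map_poly of_int r) \<alpha> = 0"
    using p q by (simp add: r_def map_poly_of_int_diff map_poly_of_int_smult)
  ultimately have "degree p \<le> degree r" by (rule min)
  moreover have "degree r \<le> degree p"
    unfolding r_def using q
    by (intro degree_diff_le) (meson degree_smult_le order_trans)+
  ultimately have "degree r = degree p" by simp
  then have "lead_coeff r = 0" by (simp add: r_def)
  with \<open>r \<noteq> 0\<close> show False by simp
qed

text \<open>The description in the definition of \<^const>\<open>min_int_poly\<close> denotes. A polynomial of minimal
  degree exists and can be made primitive with positive leading coefficient; two such polynomials
  are proportional, and equal content and sign make them equal.\<close>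

lemma min_int_poly:
  fixes \<alpha> :: "'a::field_char_0"
  assumes "algebraic \<alpha>"
  shows "content (min_int_poly \<alpha>) = 1" "lead_coeff (min_int_poly \<alpha>) > 0"
    "poly (map_poly of_int (min_int_poly \<alpha>)) \<alpha> = 0"
    "\<And>q::int poly. q \<noteq> 0 \<Longrightarrow> poly (map_poly of_int q) \<alpha> = 0 \<Longrightarrow> degree (min_int_poly \<alpha>) \<le> degree q"
proof -
  define R where "R = (\<lambda>q::int poly. q \<noteq> 0 \<and> poly (map_poly of_int q) \<alpha> = 0)"
  define P where "P = (\<lambda>p::int poly. content p = 1 \<and> lead_coeff p > 0 \<and>
     poly (map_poly of_int p) \<alpha> = 0 \<and> (\<forall>q. R q \<longrightarrow> degree p \<le> degree q))"
  have "\<exists>q. R q"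
    using assms unfolding R_def by (metis algebraicE')
  then obtain m where m: "R m" "\<And>q. R q \<Longrightarrow> degree m \<le> degree q"
    using ex_has_least_nat[of R _ degree] by blast
  \<comment> \<open>The primitive part keeps the sign of \<open>m\<close>, so the sign is corrected separately.\<close>
  define p where "p = smult (sgn (lead_coeff m)) (primitive_part m)"
  have s: "sgn (lead_coeff m) \<noteq> 0" and m0: "m \<noteq> 0"
    using m(1) by (auto simp: R_def sgn_0_0)
  have eq: "smult (content m) (primitive_part m) = m" by simp
  have cpos: "content m > 0"
    using m0 content_eq_zero_iff[of m] normalize_content[of m]
    by (metis abs_ge_zero normalize_int_def order_le_less)
  have "P p" unfolding P_def
  proof (intro conjI allI impI)
    show "content p = 1" using s m0 by (simp add: p_def sgn_if)
    have "lead_coeff m = content m * lead_coeff (primitive_part m)"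
      by (subst (1 2) eq[symmetric], subst lead_coeff_smult) simp
    then show "lead_coeff p > 0"
      using cpos m0 by (auto simp: p_def sgn_if zero_less_mult_iff mult_less_0_iff split: if_splits)
    have "of_int (content m) * poly (map_poly of_int (primitive_part m)) \<alpha> = 0"
      using m(1) unfolding R_def
      by (metis eq map_poly_of_int_smult poly_smult)
    then show "poly (map_poly of_int p) \<alpha> = 0"
      using cpos m0 by (simp add: p_def map_poly_of_int_smult)
    show "degree p \<le> degree q" if "R q" for q
      using m(2)[OF that] s by (simp add: p_def)
  qed
  moreover have "p' = p" if "P p'" for p'
  proof -
    have "R p" "R p'" using that \<open>P p\<close> unfolding P_def R_def by auto
    then have d: "degree p' = degree p"
      using that \<open>P p\<close> unfolding P_def by (meson le_antisym)
    have "smult (lead_coeff p) p' = smult (coeff p' (degree p)) p"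
      using \<open>P p\<close> \<open>R p'\<close> d unfolding P_def R_def
      by (intro minimal_int_poly_proportional) auto
    then have *: "smult (lead_coeff p) p' = smult (lead_coeff p') p" by (simp only: d)
    then have "lead_coeff p = lead_coeff p'"
      using that \<open>P p\<close> unfolding P_def
      by (metis abs_of_pos content_smult mult.right_neutral normalize_int_def)
    with * have "smult (lead_coeff p) (p' - p) = 0" by (simp add: smult_diff_right)
    then show ?thesis using \<open>R p\<close> by (simp add: R_def)
  qed
  moreover have "min_int_poly \<alpha> = (THE p. P p)"
    unfolding min_int_poly_def P_def R_def by simp
  ultimately have "P (min_int_poly \<alpha>)"
    by (metis theI)
  then show "content (min_int_poly \<alpha>) = 1" "lead_coeff (min_int_poly \<alpha>) > 0"
    "poly (map_poly of_int (min_int_poly \<alpha>)) \<alpha> = 0"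
    "\<And>q::int poly. q \<noteq> 0 \<Longrightarrow> poly (map_poly of_int q) \<alpha> = 0 \<Longrightarrow> degree (min_int_poly \<alpha>) \<le> degree q"
    unfolding P_def R_def by auto
qed

lemma poly_map_of_int_quadratic:
  "poly (map_poly of_int [:a, b, c:]) z = (of_int a + of_int b * z + of_int c * z\<^sup>2 :: 'a::comm_ring_1)"
  by (simp add: map_poly_pCons algebra_simps power2_eq_square)

lemma quadratic_relation_trivial:
  fixes \<xi> :: real
  assumes irr: "\<xi> \<notin> \<rat>" and nq: "\<not> (algebraic \<xi> \<and> alg_degree \<xi> = 2)"
    and rel: "of_int a + of_int b * \<xi> + of_int c * \<xi>\<^sup>2 = 0"
  shows "a = 0" "b = 0" "c = 0"
proof -
  have "[:a, b, c:] = 0"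
  proof (rule ccontr)
    assume nz: "[:a, b, c:] \<noteq> 0"
    have root: "poly (map_poly of_int [:a, b, c:]) \<xi> = 0"
      using rel by (subst poly_map_of_int_quadratic)
    have alg: "algebraic \<xi>"
      by (rule algebraicI[OF _ _ root]) (use nz in \<open>auto simp: coeff_map_poly map_poly_eq_0_iff\<close>)
    let ?p = "min_int_poly \<xi>"
    have "degree ?p \<le> 2"
      using min_int_poly(4)[OF alg nz root] degree_pCons_le[of a "[:b, c:]"]
        degree_pCons_le[of b "[:c:]"] by simp
    then have "degree ?p \<le> 1"
      using alg nq by (simp add: alg_degree_def)
    then obtain u v where p: "?p = [:u, v:]"
      by (cases ?p) (auto simp: Suc_le_eq split: if_splits elim!: degree_eq_zeroE)
    have "v \<noteq> 0 \<or> u \<noteq> 0"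
      using min_int_poly(2)[OF alg] p by auto
    moreover have "of_int u + of_int v * \<xi> = 0"
      using min_int_poly(3)[OF alg] p by (simp add: map_poly_pCons algebra_simps)
    ultimately have "v \<noteq> 0" and "\<xi> * of_int v = of_int (- u)"
      by (auto simp: algebra_simps add_eq_0_iff)
    then have "\<xi> = of_int (- u) / of_int v" by (metis nonzero_eq_divide_eq of_int_0_eq_iff)
    then have "\<xi> \<in> \<rat>" by (metis Rats_divide Rats_of_int)
    with irr show False ..
  qed
  then show "a = 0" "b = 0" "c = 0" by simp_all
qed

text \<open>An integer polynomial of degree at most 2 with the quadratic root \<open>\<alpha>\<close> is a rational multiple of
  the minimal polynomial. The factorisation holds for the zero polynomial too, so \<open>c\<close> may vanish.\<close>

lemma poly_eq_quadratic_conjugate: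
  fixes \<alpha> z :: complex
  assumes alg: "algebraic \<alpha>" and deg: "alg_degree \<alpha> = 2"
    and root: "of_int a + of_int b * \<alpha> + of_int c * \<alpha>\<^sup>2 = 0"
  shows "of_int a + of_int b * z + of_int c * z\<^sup>2 = of_int c * (z - \<alpha>) * (z - quadratic_conjugate \<alpha>)"
proof -
  let ?p = "min_int_poly \<alpha>"
  have d: "degree ?p = 2" using deg by (simp add: alg_degree_def)
  then obtain u v w where p: "?p = [:u, v, w:]" and w: "w \<noteq> 0"
    by (metis degree2_coeffs)
  have pz: "poly (map_poly of_int ?p) y = of_int u + of_int v * y + of_int w * y\<^sup>2" for y :: complex
    unfolding p by (rule poly_map_of_int_quadratic)
  have pa: "of_int u + of_int v * \<alpha> + of_int w * \<alpha>\<^sup>2 = 0"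
    using min_int_poly(3)[OF alg] pz by simp
  define \<beta> where "\<beta> = - of_int v / of_int w - \<alpha>"
  have "of_int w * (\<alpha> + \<beta>) = - of_int v" using w by (simp add: \<beta>_def)
  then have v: "of_int v = - (of_int w * (\<alpha> + \<beta>))" by simp
  then have u: "of_int u = of_int w * \<alpha> * \<beta>"
    using pa unfolding v by (simp add: eq_neg_iff_add_eq_0 algebra_simps power2_eq_square)
  have fac: "poly (map_poly of_int ?p) y = of_int w * (y - \<alpha>) * (y - \<beta>)" for y
    unfolding pz u v by (simp add: algebra_simps power2_eq_square)
  \<comment> \<open>A double root would also be a root of the derivative, which has degree 1.\<close>
  have "\<beta> \<noteq> \<alpha>"
  proof
    assume "\<beta> = \<alpha>"
    then have "poly (map_poly of_int [:v, 2 * w:]) \<alpha> = 0"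
      using v by (simp add: map_poly_pCons algebra_simps)
    from min_int_poly(4)[OF alg _ this] w d show False by simp
  qed
  then have conj: "quadratic_conjugate \<alpha> = \<beta>"
    unfolding quadratic_conjugate_def fac using w by (intro the_equality) auto
  have "degree [:a, b, c:] \<le> degree ?p"
    unfolding d using degree_pCons_le[of a "[:b, c:]"] degree_pCons_le[of b "[:c:]"] by simp
  moreover have "poly (map_poly of_int [:a, b, c:]) \<alpha> = 0"
    using root by (subst poly_map_of_int_quadratic)
  ultimately have "smult (lead_coeff ?p) [:a, b, c:] = smult (coeff [:a, b, c:] (degree ?p)) ?p"
    using min_int_poly(3,4)[OF alg] by (intro minimal_int_poly_proportional) auto
  then have "w * a = c * u" "w * b = c * v"
    using w unfolding d by (simp_all add: p numeral_2_eq_2)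
  then have *: "of_int w * (of_int a::complex) = of_int c * of_int u"
    "of_int w * (of_int b::complex) = of_int c * of_int v"
    by (metis of_int_mult)+
  have "of_int w * (of_int a + of_int b * z + of_int c * z\<^sup>2)
      = of_int c * (of_int u + of_int v * z + of_int w * z\<^sup>2)"
    by (simp add: distrib_left * flip: mult.assoc)
  also have "\<dots> = of_int w * (of_int c * (z - \<alpha>) * (z - \<beta>))"
    unfolding pz[symmetric] fac by simp
  finally show ?thesis using w unfolding conj by simp
qed

section \<open>The quadratic forms attached to the matrices\<close>

lemma Fform_explicit:
  "Fform x M i = [:[:0, 0, - Wmat x M i $ 2 $ 1:], [:0, Wmat x M i $ 1 $ 1 - Wmat x M i $ 2 $ 2:],
     [:Wmat x M i $ 1 $ 2:]:]"
  unfolding Fform_def UTvec_def Jmat_def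
  by (simp add: sum_2 vector_matrix_mult_def matrix_matrix_mult_def map_matrix_def
      of_int_poly algebra_simps)

lemma at_U_eq_1_Fform:
  "at_U_eq_1 (Fform x M i) = [:- Wmat x M i $ 2 $ 1, Wmat x M i $ 1 $ 1 - Wmat x M i $ 2 $ 2,
     Wmat x M i $ 1 $ 2:]"
  unfolding Fform_explicit at_U_eq_1_def by (simp add: map_poly_pCons)

lemma entries_gcd_times_prim_mult:
  "entries_gcd (A ** B) * (A \<star> B) $ i $ j = (A ** B) $ i $ j"
  unfolding prim_mult_def entries_gcd_def
  by (auto intro!: dvd_mult_div_cancel Gcd_dvd)

lemma matrix_norm_2:
  "matrix_norm A = max (max \<bar>real_of_int (A$1$1)\<bar> \<bar>real_of_int (A$1$2)\<bar>)
     (max \<bar>real_of_int (A$2$1)\<bar> \<bar>real_of_int (A$2$2)\<bar>)"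
  unfolding matrix_norm_def infnorm_Max
  by (simp add: Basis_vec_def UNIV_2 inner_axis map_matrix_def ac_simps)

lemma infnorm_row_times_matrix:
  "infnorm (vector [\<xi>, - 1] v* (map_matrix of_int A :: real^2^2)) =
    max \<bar>of_int (A$1$1) * \<xi> - of_int (A$2$1)\<bar> \<bar>of_int (A$1$2) * \<xi> - of_int (A$2$2)\<bar>"
  unfolding infnorm_2 by (simp add: vector_matrix_mult_def sum_2 map_matrix_def mult.commute)

section \<open>Asymptotics of the second root\<close>

text \<open>The term \<open>g\<close> is eventually at most half of \<open>h\<close> and can be absorbed on the left.\<close>

lemma bigo_of_le_add_small:
  fixes f g h :: "'i \<Rightarrow> real"
  assumes le: "eventually (\<lambda>i. \<bar>h i\<bar> \<le> f i + g i) F" and g: "g \<in> o[F](h)"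
  shows "h \<in> O[F](f)"
proof (rule bigoI)
  have "eventually (\<lambda>i. norm (g i) \<le> 1/2 * norm (h i)) F"
    using landau_o.smallD[OF g, of "1/2"] by simp
  with le show "eventually (\<lambda>i. norm (h i) \<le> 2 * norm (f i)) F"
    by eventually_elim (auto simp: abs_if split: if_splits)
qed

text \<open>The analytic core. The matrix \<open>(x0, x1; x1, x2)\<close> has norm \<open>X\<close>, \<open>(e1, e2)\<close> is its product with the
  row \<open>(\<xi>, -1)\<close>, and \<open>\<alpha>\<close>, \<open>\<beta>\<close> are the roots of the quadratic polynomial \<open>(z, -1) x N (1, z)\<^sup>T\<close>, where
  \<open>N = (a, b; c, d)\<close>. With \<open>s = - (a + b\<xi>) / (c + d\<xi>)\<close> and \<open>t = - (a + c\<xi>) / (b + d\<xi>)\<close>, the value of the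
  polynomial at \<open>\<xi>\<close> is \<open>(c + d\<xi>) (e2 - s e1)\<close>, and at \<open>t\<close> it is a non-zero multiple of \<open>t e1 - e2\<close>.
  Since \<open>\<alpha>\<close> is very close to \<open>\<xi>\<close>, the first value is negligible, so \<open>(e1, e2)\<close> is nearly proportional to
  \<open>(1, s)\<close>; as \<open>s \<noteq> t\<close>, no cancellation occurs in \<open>t e1 - e2\<close>, which therefore has order \<open>1/X\<close>.
  Division by the leading coefficient, of order \<open>X\<close>, and by \<open>t - \<alpha>\<close>, of order 1, gives \<open>t - \<beta>\<close>.\<close>

lemma conjugate_root_asymptotics:
  fixes x0 x1 x2 X :: "'i \<Rightarrow> real" and \<alpha> \<beta> :: "'i \<Rightarrow> complex" and a b c d \<xi> :: real
  assumes X_top: "filterlim X at_top F"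
    and X_eq: "eventually (\<lambda>i. X i = max \<bar>x0 i\<bar> (max \<bar>x1 i\<bar> \<bar>x2 i\<bar>)) F"
    and eps: "(\<lambda>i. max \<bar>x0 i * \<xi> - x1 i\<bar> \<bar>x1 i * \<xi> - x2 i\<bar>) \<in> \<Theta>[F](\<lambda>i. 1 / X i)"
    and close: "(\<lambda>i. cmod (of_real \<xi> - \<alpha> i)) \<in> o[F](\<lambda>i. 1 / (X i)\<^sup>2)"
    and nz: "b + d * \<xi> \<noteq> 0" "c + d * \<xi> \<noteq> 0" "a * d - b * c \<noteq> 0" "a + (b + c) * \<xi> + d * \<xi>\<^sup>2 \<noteq> 0" "b \<noteq> c"
    and factor: "eventually (\<lambda>i. \<forall>z.
      (z * of_real (x0 i) - of_real (x1 i)) * (of_real a + of_real b * z)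
        + (z * of_real (x1 i) - of_real (x2 i)) * (of_real c + of_real d * z)
      = of_real (b * x0 i + d * x1 i) * (z - \<alpha> i) * (z - \<beta> i)) F"
  shows "(\<lambda>i. cmod (of_real (- (a + c * \<xi>) / (b + d * \<xi>)) - \<beta> i)) \<in> \<Theta>[F](\<lambda>i. 1 / (X i)\<^sup>2)"
proof -
  define s t where "s = - (a + b * \<xi>) / (c + d * \<xi>)" and "t = - (a + c * \<xi>) / (b + d * \<xi>)"
  define e1 e2 where "e1 = (\<lambda>i. x0 i * \<xi> - x1 i)" and "e2 = (\<lambda>i. x1 i * \<xi> - x2 i)"
  define E where "E = (\<lambda>i. max \<bar>e1 i\<bar> \<bar>e2 i\<bar>)"
  have E: "E \<in> \<Theta>[F](\<lambda>i. 1 / X i)"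
    using eps by (simp add: E_def e1_def e2_def)
  have s_eq: "s * (c + d * \<xi>) = - (a + b * \<xi>)" and t_eq: "t * (b + d * \<xi>) = - (a + c * \<xi>)"
    using nz by (simp_all add: s_def t_def)
  \<comment> \<open>Clearing denominators, \<open>s = t\<close> says that \<open>b - c\<close> times the quadratic expression in \<open>\<xi>\<close> vanishes.\<close>
  have st: "s \<noteq> t"
  proof
    assume "s = t"
    have "(a + b * \<xi>) * (b + d * \<xi>) = (a + c * \<xi>) * (c + d * \<xi>)"
      using s_eq t_eq \<open>s = t\<close> by algebra
    then have "(b - c) * (a + (b + c) * \<xi> + d * \<xi>\<^sup>2) = 0" by algebra
    with nz show False by simp
  qed
  have t\<xi>: "t \<noteq> \<xi>"
  proof
    assume "t = \<xi>"
    with t_eq have "\<xi> * (b + d * \<xi>) = - (a + c * \<xi>)" by simp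
    then have "a + (b + c) * \<xi> + d * \<xi>\<^sup>2 = 0" by algebra
    with nz show False by simp
  qed
  have X_ge: "eventually (\<lambda>i. X i \<ge> 1) F"
    using X_top by (rule filterlim_at_top[THEN iffD1, rule_format])
  have inv_small: "(\<lambda>i. 1 / X i) \<in> o[F](\<lambda>_. 1)"
    using tendsto_divide_0[OF tendsto_const filterlim_at_top_imp_at_infinity[OF X_top], of 1]
    by (intro smalloI_tendsto) auto
  have one_X: "(\<lambda>_. 1) \<in> O[F](X)"
    using X_ge by (intro bigoI[of _ 1]) (auto elim!: eventually_mono)
  have small_X: "(\<lambda>i. 1 / X i) \<in> o[F](X)"
    using inv_small one_X by (rule landau_o.small_big_trans)
  have "e1 \<in> O[F](E)" "e2 \<in> O[F](E)"
    by (auto intro!: bigoI[of _ 1] simp: E_def)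
  then have e1_O: "e1 \<in> O[F](\<lambda>i. 1 / X i)" and e2_O: "e2 \<in> O[F](\<lambda>i. 1 / X i)"
    using bigthetaD1[OF E] by (auto intro: landau_o.big_trans)

  \<comment> \<open>The entries of the matrix are \<open>x0 (1, \<xi>, \<xi>\<^sup>2)\<close> up to a small error.\<close>
  have x0: "x0 \<in> \<Theta>[F](X)"
  proof
    show "x0 \<in> O[F](X)"
    proof (rule bigoI)
      show "eventually (\<lambda>i. norm (x0 i) \<le> 1 * norm (X i)) F"
        using X_eq X_ge by eventually_elim simp
    qed
    have "X \<in> O[F](\<lambda>i. (1 + \<bar>\<xi>\<bar> + \<xi>\<^sup>2) * \<bar>x0 i\<bar>)"
    proof (rule bigo_of_le_add_small)
      have "(\<lambda>i. (1 + \<bar>\<xi>\<bar>) * \<bar>e1 i\<bar> + \<bar>e2 i\<bar>) \<in> O[F](\<lambda>i. 1 / X i)"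
        using e1_O e2_O by (intro sum_in_bigo) auto
      then show "(\<lambda>i. (1 + \<bar>\<xi>\<bar>) * \<bar>e1 i\<bar> + \<bar>e2 i\<bar>) \<in> o[F](X)"
        using small_X by (rule landau_o.big_small_trans)
      show "eventually (\<lambda>i. \<bar>X i\<bar> \<le> (1 + \<bar>\<xi>\<bar> + \<xi>\<^sup>2) * \<bar>x0 i\<bar> + ((1 + \<bar>\<xi>\<bar>) * \<bar>e1 i\<bar> + \<bar>e2 i\<bar>)) F"
        using X_eq X_ge
      proof eventually_elim
        case (elim i)
        let ?B = "\<bar>x0 i\<bar> + \<bar>\<xi>\<bar> * \<bar>x0 i\<bar> + \<xi>\<^sup>2 * \<bar>x0 i\<bar> + \<bar>e1 i\<bar> + \<bar>\<xi>\<bar> * \<bar>e1 i\<bar> + \<bar>e2 i\<bar>"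
        have x1: "x1 i = \<xi> * x0 i - e1 i" and x2: "x2 i = \<xi>\<^sup>2 * x0 i - \<xi> * e1 i - e2 i"
          by (simp_all add: e1_def e2_def algebra_simps power2_eq_square)
        have "\<bar>x1 i\<bar> \<le> \<bar>\<xi>\<bar> * \<bar>x0 i\<bar> + \<bar>e1 i\<bar>"
          unfolding x1 by (metis abs_mult abs_triangle_ineq4)
        moreover have "\<bar>x2 i\<bar> \<le> \<xi>\<^sup>2 * \<bar>x0 i\<bar> + \<bar>\<xi>\<bar> * \<bar>e1 i\<bar> + \<bar>e2 i\<bar>"
        proof -
          have "\<bar>x2 i\<bar> \<le> \<bar>\<xi>\<^sup>2 * x0 i\<bar> + \<bar>\<xi> * e1 i\<bar> + \<bar>e2 i\<bar>" unfolding x2 by linarith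
          then show ?thesis by (simp add: abs_mult)
        qed
        moreover have "0 \<le> \<bar>\<xi>\<bar> * \<bar>x0 i\<bar>" "0 \<le> \<xi>\<^sup>2 * \<bar>x0 i\<bar>" "0 \<le> \<bar>\<xi>\<bar> * \<bar>e1 i\<bar>"
          by simp_all
        ultimately have "\<bar>x0 i\<bar> \<le> ?B" "\<bar>x1 i\<bar> \<le> ?B" "\<bar>x2 i\<bar> \<le> ?B" by linarith+
        then have "X i \<le> ?B" unfolding elim(1) by (intro max.boundedI)
        moreover have "?B = (1 + \<bar>\<xi>\<bar> + \<xi>\<^sup>2) * \<bar>x0 i\<bar> + ((1 + \<bar>\<xi>\<bar>) * \<bar>e1 i\<bar> + \<bar>e2 i\<bar>)"
          by (simp add: distrib_right)
        ultimately show ?case using elim(2) by linarith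
      qed
    qed
    moreover have "1 + \<bar>\<xi>\<bar> + \<xi>\<^sup>2 \<noteq> 0"
      by (smt (verit) zero_le_power2)
    ultimately show "x0 \<in> \<Omega>[F](X)"
      by (simp add: bigomega_iff_bigo)
  qed

  have lead: "(\<lambda>i. b * x0 i + d * x1 i) \<in> \<Theta>[F](X)"
  proof -
    have "(\<lambda>i. d * e1 i) \<in> o[F](X)"
      using landau_o.big_small_trans[OF e1_O small_X] by (cases "d = 0") auto
    then have "(\<lambda>i. d * e1 i) \<in> o[F](\<lambda>i. (b + d * \<xi>) * x0 i)"
      using nz x0 by (simp add: landau_o.small.cong_bigtheta)
    then have "(\<lambda>i. (b + d * \<xi>) * x0 i - d * e1 i) \<in> \<Theta>[F](\<lambda>i. (b + d * \<xi>) * x0 i)"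
      by (metis bigtheta_refl landau_theta.diff_absorb2)
    also have "(\<lambda>i. (b + d * \<xi>) * x0 i) \<in> \<Theta>[F](X)" using nz x0 by simp
    finally show ?thesis by (simp add: e1_def algebra_simps)
  qed

  have \<alpha>_lim: "((\<lambda>i. cmod (of_real \<xi> - \<alpha> i)) \<longlongrightarrow> 0) F"
  proof -
    have "(\<lambda>i. 1 / (X i)\<^sup>2) \<in> O[F](\<lambda>_. 1)"
      using X_ge by (intro bigoI[of _ 1]) (auto elim!: eventually_mono simp: divide_le_eq)
    from landau_o.small_big_trans[OF close this] show ?thesis
      by (rule smalloD_tendsto[of _ _ "\<lambda>_. 1", simplified])
  qed

  define q where "q = (\<lambda>i. e2 i - s * e1 i)"
  define C where "C = (\<bar>b\<bar> + \<bar>d\<bar>) * (2 * \<bar>\<xi>\<bar> + 1) + (\<bar>a\<bar> + \<bar>b\<bar> + \<bar>c\<bar> + \<bar>d\<bar>)"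
  have q: "q \<in> o[F](\<lambda>i. 1 / X i)"
  proof -
    have "eventually (\<lambda>i. cmod (of_real \<xi> - \<alpha> i) < 1) F"
      using \<alpha>_lim by (rule order_tendstoD) simp
    with factor X_eq have
      "eventually (\<lambda>i. norm ((c + d * \<xi>) * q i) \<le> C * norm (X i * cmod (of_real \<xi> - \<alpha> i))) F"
    proof eventually_elim
      case (elim i)
      have X: "\<bar>x0 i\<bar> \<le> X i" "\<bar>x1 i\<bar> \<le> X i" "\<bar>x2 i\<bar> \<le> X i"
        unfolding elim(2) by (simp_all add: le_max_iff_disj)
      then have X0: "0 \<le> X i" by linarith
      let ?l = "of_real (b * x0 i + d * x1 i) :: complex"
      let ?m = "of_real (a * x0 i - b * x1 i + c * x1 i - d * x2 i) :: complex"
      \<comment> \<open>The polynomial vanishes at \<open>\<alpha> i\<close>, so its value at \<open>\<xi>\<close> is divisible by \<open>\<xi> - \<alpha> i\<close>.\<close>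
      have root: "(\<alpha> i * of_real (x0 i) - of_real (x1 i)) * (of_real a + of_real b * \<alpha> i)
        + (\<alpha> i * of_real (x1 i) - of_real (x2 i)) * (of_real c + of_real d * \<alpha> i) = 0"
        using elim(1) by simp
      have "(c + d * \<xi>) * q i = e1 i * (a + b * \<xi>) + e2 i * (c + d * \<xi>)"
        using s_eq unfolding q_def by algebra
      then have "of_real ((c + d * \<xi>) * q i) =
        (of_real \<xi> * of_real (x0 i) - of_real (x1 i)) * (of_real a + of_real b * of_real \<xi>)
        + (of_real \<xi> * of_real (x1 i) - of_real (x2 i)) * (of_real c + of_real d * of_real \<xi> :: complex)"
        by (simp add: e1_def e2_def mult.commute)
      also have "\<dots> = (of_real \<xi> - \<alpha> i) * (?l * (of_real \<xi> + \<alpha> i) + ?m)"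
        using root by (simp del: of_real_mult of_real_add of_real_diff add: algebra_simps) (simp add: algebra_simps)
      finally have "norm ((c + d * \<xi>) * q i) = cmod ((of_real \<xi> - \<alpha> i) * (?l * (of_real \<xi> + \<alpha> i) + ?m))"
        by (metis norm_of_real real_norm_def)
      also have "\<dots> \<le> cmod (of_real \<xi> - \<alpha> i) * (C * X i)"
      proof -
        have bd: "\<bar>u * y\<bar> \<le> \<bar>u\<bar> * X i" if "\<bar>y\<bar> \<le> X i" for u y :: real
          using that by (simp add: abs_mult mult_left_mono)
        have l: "cmod ?l \<le> (\<bar>b\<bar> + \<bar>d\<bar>) * X i"
          unfolding norm_of_real using bd[OF X(1), of b] bd[OF X(2), of d] by (simp add: distrib_right)
        have m: "cmod ?m \<le> (\<bar>a\<bar> + \<bar>b\<bar> + \<bar>c\<bar> + \<bar>d\<bar>) * X i"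
          unfolding norm_of_real distrib_right
          using bd[OF X(1), of a] bd[OF X(2), of b] bd[OF X(2), of c] bd[OF X(3), of d]
          by linarith
        have "cmod (of_real \<xi> + \<alpha> i) \<le> 2 * \<bar>\<xi>\<bar> + 1"
          using norm_triangle_ineq4[of "2 * complex_of_real \<xi>" "of_real \<xi> - \<alpha> i"] elim(3)
          by (simp add: norm_mult)
        then have "cmod (?l * (of_real \<xi> + \<alpha> i)) \<le> ((\<bar>b\<bar> + \<bar>d\<bar>) * X i) * (2 * \<bar>\<xi>\<bar> + 1)"
          unfolding norm_mult using l X0 by (intro mult_mono) auto
        with m have "cmod (?l * (of_real \<xi> + \<alpha> i) + ?m) \<le> C * X i"
          using norm_triangle_ineq[of "?l * (of_real \<xi> + \<alpha> i)" ?m]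
          by (simp add: C_def algebra_simps)
        then show ?thesis unfolding norm_mult by (intro mult_left_mono) auto
      qed
      also have "\<dots> = C * norm (X i * cmod (of_real \<xi> - \<alpha> i))"
        using X0 by (simp add: abs_mult)
      finally show ?case .
    qed
    then have "(\<lambda>i. (c + d * \<xi>) * q i) \<in> O[F](\<lambda>i. X i * cmod (of_real \<xi> - \<alpha> i))"
      by (rule bigoI)
    then have "q \<in> O[F](\<lambda>i. X i * cmod (of_real \<xi> - \<alpha> i))" using nz by simp
    also have "(\<lambda>i. X i * cmod (of_real \<xi> - \<alpha> i)) \<in> o[F](\<lambda>i. X i * (1 / (X i)\<^sup>2))"
      by (intro landau_o.small.mult_left close)
    also have "(\<lambda>i. X i * (1 / (X i)\<^sup>2)) = (\<lambda>i. 1 / X i)"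
      by (simp add: fun_eq_iff power2_eq_square)
    finally show ?thesis .
  qed

  \<comment> \<open>Hence \<open>(e1, e2)\<close> is almost a multiple of \<open>(1, s)\<close>.\<close>
  have e1: "e1 \<in> \<Theta>[F](\<lambda>i. 1 / X i)"
  proof
    show "e1 \<in> O[F](\<lambda>i. 1 / X i)" by (rule e1_O)
    have "E \<in> O[F](\<lambda>i. (1 + \<bar>s\<bar>) * \<bar>e1 i\<bar>)"
    proof (rule bigo_of_le_add_small)
      show "(\<lambda>i. \<bar>q i\<bar>) \<in> o[F](E)" using q E by (simp add: landau_o.small.cong_bigtheta)
      have "\<bar>E i\<bar> \<le> (1 + \<bar>s\<bar>) * \<bar>e1 i\<bar> + \<bar>q i\<bar>" for i
      proof -
        have "\<bar>e2 i\<bar> \<le> \<bar>s\<bar> * \<bar>e1 i\<bar> + \<bar>q i\<bar>"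
          unfolding q_def abs_mult[symmetric] by simp
        moreover have "0 \<le> \<bar>s\<bar> * \<bar>e1 i\<bar>" by simp
        ultimately have "\<bar>e1 i\<bar> \<le> (1 + \<bar>s\<bar>) * \<bar>e1 i\<bar> + \<bar>q i\<bar>" "\<bar>e2 i\<bar> \<le> (1 + \<bar>s\<bar>) * \<bar>e1 i\<bar> + \<bar>q i\<bar>"
          unfolding distrib_right by linarith+
        then have "E i \<le> (1 + \<bar>s\<bar>) * \<bar>e1 i\<bar> + \<bar>q i\<bar>" by (simp add: E_def)
        moreover have "0 \<le> E i" by (simp add: E_def le_max_iff_disj)
        ultimately show ?thesis by simp
      qed
      then show "eventually (\<lambda>i. \<bar>E i\<bar> \<le> (1 + \<bar>s\<bar>) * \<bar>e1 i\<bar> + \<bar>q i\<bar>) F" by simp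
    qed
    moreover have "1 + \<bar>s\<bar> \<noteq> 0" by linarith
    ultimately have "E \<in> O[F](e1)" by simp
    then show "e1 \<in> \<Omega>[F](\<lambda>i. 1 / X i)"
      using E by (simp add: bigomega_iff_bigo landau_o.big.in_cong_bigtheta[of E])
  qed

  have num: "(\<lambda>i. t * e1 i - e2 i) \<in> \<Theta>[F](\<lambda>i. 1 / X i)"
  proof -
    have *: "(\<lambda>i. (t - s) * e1 i) \<in> \<Theta>[F](\<lambda>i. 1 / X i)" using e1 st by simp
    then have "q \<in> o[F](\<lambda>i. (t - s) * e1 i)" using q
      by (simp only: landau_o.small.cong_bigtheta)
    then have "(\<lambda>i. (t - s) * e1 i - q i) \<in> \<Theta>[F](\<lambda>i. (t - s) * e1 i)"
      by (metis bigtheta_refl landau_theta.diff_absorb2)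
    also note *
    finally show ?thesis by (simp add: q_def algebra_simps)
  qed

  have dist: "(\<lambda>i. cmod (of_real t - \<alpha> i)) \<in> \<Theta>[F](\<lambda>_. 1)"
  proof (rule bigthetaI_tendsto_norm)
    have "((\<lambda>i. of_real \<xi> - \<alpha> i) \<longlongrightarrow> 0) F"
      using \<alpha>_lim by (rule tendsto_norm_zero_cancel)
    then have "((\<lambda>i. cmod (of_real t - of_real \<xi> + (of_real \<xi> - \<alpha> i))) \<longlongrightarrow> cmod (of_real t - of_real \<xi> + 0)) F"
      by (intro tendsto_intros)
    then show "((\<lambda>i. norm (cmod (of_real t - \<alpha> i) / 1)) \<longlongrightarrow> cmod (of_real t - of_real \<xi>)) F"
      by simp
  qed (use t\<xi> in simp)

  \<comment> \<open>\<open>t\<close> is chosen so that \<open>N (1, t)\<^sup>T\<close> is orthogonal to \<open>(1, \<xi>)\<close>, hence equal to \<open>\<mu> (\<xi>, -1)\<^sup>T\<close>.\<close>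
  define \<mu> where "\<mu> = (a * d - b * c) / (b + d * \<xi>)"
  have \<mu>: "a + b * t = \<mu> * \<xi>" "c + d * t = - \<mu>"
    using nz t_eq unfolding \<mu>_def by (simp_all add: divide_simps t_def algebra_simps)
  have "\<mu> \<noteq> 0" using nz by (simp add: \<mu>_def)
  have val: "eventually (\<lambda>i. \<bar>\<mu> * (t * e1 i - e2 i)\<bar> =
      \<bar>b * x0 i + d * x1 i\<bar> * cmod (of_real t - \<alpha> i) * cmod (of_real t - \<beta> i)) F"
    using factor
  proof eventually_elim
    case (elim i)
    have "\<mu> * (t * e1 i - e2 i) = (t * x0 i - x1 i) * (a + b * t) + (t * x1 i - x2 i) * (c + d * t)"
      unfolding \<mu> by (simp add: e1_def e2_def algebra_simps)
    then have "of_real (\<mu> * (t * e1 i - e2 i)) =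
      of_real (b * x0 i + d * x1 i) * (of_real t - \<alpha> i) * (of_real t - \<beta> i)"
      using spec[OF elim, of "of_real t"] by simp
    then have "cmod (of_real (\<mu> * (t * e1 i - e2 i))) =
      cmod (of_real (b * x0 i + d * x1 i) * (of_real t - \<alpha> i) * (of_real t - \<beta> i))"
      by (rule arg_cong)
    then show ?case by (simp only: norm_mult norm_of_real)
  qed
  have den: "(\<lambda>i. \<bar>b * x0 i + d * x1 i\<bar> * cmod (of_real t - \<alpha> i)) \<in> \<Theta>[F](X)"
    using landau_theta.mult[OF landau_theta.abs_in_iff[THEN iffD2, OF lead] dist] by simp
  have X_nz: "eventually (\<lambda>i. X i \<noteq> 0) F" using X_ge by eventually_elim auto
  then have den_nz: "eventually (\<lambda>i. \<bar>b * x0 i + d * x1 i\<bar> * cmod (of_real t - \<alpha> i) \<noteq> 0) F"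
    using eventually_nonzero_bigtheta[OF den] by simp
  with val have eq: "eventually (\<lambda>i. cmod (of_real t - \<beta> i) =
      \<bar>\<mu> * (t * e1 i - e2 i)\<bar> / (\<bar>b * x0 i + d * x1 i\<bar> * cmod (of_real t - \<alpha> i))) F"
    by eventually_elim (simp add: eq_divide_eq ac_simps)
  have "(\<lambda>i. \<bar>\<mu> * (t * e1 i - e2 i)\<bar> / (\<bar>b * x0 i + d * x1 i\<bar> * cmod (of_real t - \<alpha> i)))
      \<in> \<Theta>[F](\<lambda>i. (1 / X i) / X i)"
    using num \<open>\<mu> \<noteq> 0\<close> den by (intro landau_theta.divide den_nz X_nz) (simp_all add: bigtheta_sym)
  then have "(\<lambda>i. cmod (of_real t - \<beta> i)) \<in> \<Theta>[F](\<lambda>i. (1 / X i) / X i)"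
    by (subst landau_theta.in_cong[OF eq])
  then show ?thesis unfolding t_def by (simp add: power2_eq_square)
qed

section \<open>Comparability and growth\<close>

lemma comparable_on_pos:
  assumes "comparable_on I A B" "i \<in> I" "0 < B i"
  shows "0 < A i"
proof -
  obtain c where "c > 0" "c * B i \<le> A i"
    using assms unfolding comparable_on_def by auto
  then show ?thesis using mult_pos_pos[OF \<open>c > 0\<close> assms(3)] by linarith
qed

lemma comparable_on_imp_bigtheta:
  assumes "comparable_on I A B" "\<And>i. i \<in> I \<Longrightarrow> 0 \<le> B i" "eventually (\<lambda>n. r n \<in> I) F"
  shows "(\<lambda>n. A (r n)) \<in> \<Theta>[F](\<lambda>n. B (r n))"
proof -
  obtain c1 c2 where c: "c1 > 0" "c2 > 0" "\<And>i. i \<in> I \<Longrightarrow> c1 * B i \<le> A i \<and> A i \<le> c2 * B i"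
    using assms(1) unfolding comparable_on_def by blast
  have nn: "0 \<le> A i" if "i \<in> I" for i
    using c(3)[OF that] assms(2)[OF that] c(1) by (meson less_imp_le mult_nonneg_nonneg order_trans)
  show ?thesis
  proof (rule bigthetaI')
    show "eventually (\<lambda>n. c1 * norm (B (r n)) \<le> norm (A (r n)) \<and>
        norm (A (r n)) \<le> c2 * norm (B (r n))) F"
      using assms(3) by eventually_elim (use c(3) assms(2) nn in auto)
  qed (use c in auto)
qed

text \<open>Positivity lets the constants be adjusted at the finitely many early indices.\<close>

lemma bigtheta_imp_comparable_on:
  assumes theta: "A \<in> \<Theta>(B)" and pos: "\<And>i. i \<in> I \<Longrightarrow> 0 < A i" "\<And>i. i \<in> I \<Longrightarrow> 0 < B i"
  shows "comparable_on I A B"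
proof -
  obtain c1 where c1: "c1 > 0" "eventually (\<lambda>i. c1 * \<bar>B i\<bar> \<le> \<bar>A i\<bar>) sequentially"
    using landau_omega.bigE[OF bigthetaD2[OF theta]] by (auto simp: mult.commute)
  obtain c2 where c2: "c2 > 0" "eventually (\<lambda>i. \<bar>A i\<bar> \<le> c2 * \<bar>B i\<bar>) sequentially"
    using landau_o.bigE[OF bigthetaD1[OF theta]] by auto
  obtain n where n: "\<And>i. i \<ge> n \<Longrightarrow> c1 * \<bar>B i\<bar> \<le> \<bar>A i\<bar> \<and> \<bar>A i\<bar> \<le> c2 * \<bar>B i\<bar>"
    using eventually_conj[OF c1(2) c2(2)] unfolding eventually_sequentially by blast
  define R where "R = (\<lambda>i. A i / B i) ` (I \<inter> {..<n})"
  have fin: "finite R" by (simp add: R_def)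
  have Rpos: "0 < \<rho>" if "\<rho> \<in> R" for \<rho> using that pos by (auto simp: R_def)
  have "Min (insert c1 R) * B i \<le> A i \<and> A i \<le> Max (insert c2 R) * B i" if i: "i \<in> I" for i
  proof -
    have "Min (insert c1 R) \<le> A i / B i \<and> A i / B i \<le> Max (insert c2 R)"
    proof (cases "i < n")
      case True
      then have "A i / B i \<in> R" using i by (auto simp: R_def)
      then show ?thesis using fin by simp
    next
      case False
      then have "c1 \<le> A i / B i" "A i / B i \<le> c2"
        using n[of i] pos[OF i] by (auto simp: divide_le_eq le_divide_eq)
      moreover have "Min (insert c1 R) \<le> c1" "c2 \<le> Max (insert c2 R)" using fin by simp_all
      ultimately show ?thesis by linarith
    qed
    then show ?thesis using pos[OF i] by (simp add: divide_le_eq le_divide_eq)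
  qed
  moreover have "Min (insert c1 R) > 0" using fin c1 Rpos by (subst Min_gr_iff) auto
  moreover have "Max (insert c2 R) > 0" using fin c2(1) by (meson Max_ge finite_insert insertI1 less_le_trans)
  ultimately show ?thesis unfolding comparable_on_def by blast
qed

text \<open>An unbounded sequence exceeds at some index the threshold beyond which each term is at least
  twice its predecessor.\<close>

lemma filterlim_at_top_of_powr_growth:
  fixes X :: "nat \<Rightarrow> real"
  assumes "p > 1" "c > 0" and grow: "\<And>i. i \<ge> 1 \<Longrightarrow> c * X i powr p \<le> X (i + 1)"
    and unbdd: "\<And>B. \<exists>i\<ge>1. B < X i"
  shows "filterlim X at_top sequentially"
proof -
  \<comment> \<open>\<open>K\<close> is at least the solution of \<open>c K powr p = 2 K\<close>.\<close>
  define K where "K = max 1 ((2 / c) powr (1 / (p - 1)))"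
  have step: "X i + 1 \<le> X (i + 1)" if "i \<ge> 1" "K \<le> X i" for i
  proof -
    have X1: "1 \<le> X i" using that(2) by (simp add: K_def)
    have "2 / c = ((2 / c) powr (1 / (p - 1))) powr (p - 1)"
      using assms(1,2) by (simp add: powr_powr)
    also have "\<dots> \<le> X i powr (p - 1)"
      using that(2) assms(1) by (intro powr_mono2) (auto simp: K_def)
    finally have "2 \<le> c * X i powr (p - 1)" using assms(2) by (simp add: field_simps)
    then have "2 * X i \<le> (c * X i powr (p - 1)) * X i" using X1 by (intro mult_right_mono) auto
    also have "\<dots> = c * X i powr p"
      using X1 powr_add[of "X i" "p - 1" 1] by simp
    also have "\<dots> \<le> X (i + 1)" using that(1) by (rule grow)
    finally show ?thesis using X1 by linarith
  qed
  obtain n where n: "n \<ge> 1" "K < X n" using unbdd by blast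
  have lin: "K + real k \<le> X (n + k)" for k
  proof (induction k)
    case (Suc k)
    then show ?case using step[of "n + k"] n(1) by simp
  qed (use n in simp)
  have low: "(K - real n) + real i \<le> X i" if "i \<ge> n" for i
    using lin[of "i - n"] that by (simp add: of_nat_diff)
  have "filterlim (\<lambda>i. (K - real n) + real i) at_top sequentially"
    by (rule filterlim_tendsto_add_at_top[OF tendsto_const filterlim_real_sequentially])
  moreover have "eventually (\<lambda>i. (K - real n) + real i \<le> X i) sequentially"
    unfolding eventually_sequentially using low by blast
  ultimately show ?thesis by (rule filterlim_at_top_mono)
qed

lemma accumulation_points_two_limits:
  fixes u :: "nat \<Rightarrow> 'a::t2_space"
  assumes odd: "(\<lambda>k. u (2 * k - 1)) \<longlonglongrightarrow> p" and even: "(\<lambda>k. u (2 * k)) \<longlonglongrightarrow> q"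
  shows "accumulation_points u = {p, q}"
proof (intro equalityI subsetI)
  fix z assume z: "z \<in> accumulation_points u"
  show "z \<in> {p, q}"
  proof (rule ccontr)
    assume "z \<notin> {p, q}"
    then have "z \<noteq> p" "z \<noteq> q" by auto
    obtain U V where UV: "open U" "open V" "z \<in> U" "p \<in> V" "U \<inter> V = {}"
      using hausdorff[OF \<open>z \<noteq> p\<close>] by blast
    obtain U' V' where UV': "open U'" "open V'" "z \<in> U'" "q \<in> V'" "U' \<inter> V' = {}"
      using hausdorff[OF \<open>z \<noteq> q\<close>] by blast
    have "eventually (\<lambda>k. u (2 * k - 1) \<in> V \<and> u (2 * k) \<in> V') sequentially"
      using topological_tendstoD[OF odd UV(2,4)] topological_tendstoD[OF even UV'(2,4)]
      by (rule eventually_conj)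
    then obtain n where n: "\<And>k. k \<ge> n \<Longrightarrow> u (2 * k - 1) \<in> V \<and> u (2 * k) \<in> V'"
      unfolding eventually_sequentially by blast
    have "u i \<notin> U \<inter> U'" if "i \<ge> 2 * n" for i
    proof (cases "even i")
      case True
      then obtain k where "i = 2 * k" by blast
      then show ?thesis using n[of k] that UV(5) UV'(5) by auto
    next
      case False
      then obtain k where "i = 2 * k + 1" by (rule oddE)
      then show ?thesis using n[of "k + 1"] that UV(5) UV'(5) by auto
    qed
    then have "\<not> (\<exists>\<^sub>F i in sequentially. u i \<in> U \<inter> U')"
      unfolding not_frequently eventually_sequentially by blast
    moreover have "\<exists>\<^sub>F i in sequentially. u i \<in> U \<inter> U'"
      using z open_Int[OF UV(1) UV'(1)] UV(3) UV'(3) unfolding accumulation_points_def by blast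
    ultimately show False by blast
  qed
next
  have freq: "\<exists>\<^sub>F i in sequentially. u i \<in> S"
    if lim: "(\<lambda>k. u (r k)) \<longlonglongrightarrow> y" "open S" "y \<in> S" and r: "\<And>k. k \<le> r k" for r :: "nat \<Rightarrow> nat" and y S
  proof -
    obtain n where "\<And>k. k \<ge> n \<Longrightarrow> u (r k) \<in> S"
      using topological_tendstoD[OF lim] unfolding eventually_sequentially by blast
    then show ?thesis
      unfolding frequently_sequentially using r by (meson le_trans max.cobounded1 max.cobounded2)
  qed
  fix z assume "z \<in> {p, q}"
  then show "z \<in> accumulation_points u"
    unfolding accumulation_points_def using freq[OF odd] freq[OF even] by auto
qed

section \<open>Conjugates of the best quadratic approximations\<close>

lemma golden_gt_1: "golden > 1"
  unfolding golden_def using real_less_rsqrt[of 1 5] by simp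

lemma primitive_matricesD:
  assumes "A \<in> primitive_matrices"
  shows "A $ 1 $ 1 * A $ 2 $ 2 - A $ 1 $ 2 * A $ 2 $ 1 \<noteq> 0"
  using assms by (simp add: primitive_matrices_def det_2)

lemma symmetric_offdiag:
  assumes "transpose (A :: 'a^2^2) = A"
  shows "A $ 2 $ 1 = A $ 1 $ 2"
proof -
  have "transpose A $ 1 $ 2 = A $ 1 $ 2" using assms by simp
  then show ?thesis by (simp add: transpose_def)
qed

lemma transpose_primitive_matrices:
  assumes "A \<in> primitive_matrices"
  shows "transpose A \<in> primitive_matrices"
proof -
  have "{transpose A $ i $ j | i j. True} = {A $ i $ j | i j. True}"
    by (auto simp: transpose_def)
  then show ?thesis using assms by (simp add: primitive_matrices_def entries_gcd_def)
qed

lemma extremal_data_matrix_norm: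
  assumes "extremal_data \<xi> x M"
  shows "\<And>i. i \<ge> 1 \<Longrightarrow> 0 < matrix_norm (x i)" "filterlim (\<lambda>i. matrix_norm (x i)) at_top sequentially"
proof -
  show "0 < matrix_norm (x i)" if "i \<ge> 1" for i
  proof -
    have "x i \<in> primitive_matrices" using assms that by (auto simp: extremal_data_def)
    then have "x i $ 1 $ 1 \<noteq> 0 \<or> x i $ 1 $ 2 \<noteq> 0" by (auto dest: primitive_matricesD)
    then show ?thesis unfolding matrix_norm_2 by (auto simp: less_max_iff_disj)
  qed
  obtain c where c: "c > 0" "\<And>i. i \<ge> 1 \<Longrightarrow> c * matrix_norm (x i) powr golden \<le> matrix_norm (x (i + 1))"
    using assms unfolding extremal_data_def comparable_on_def by auto
  show "filterlim (\<lambda>i. matrix_norm (x i)) at_top sequentially"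
  proof (rule filterlim_at_top_of_powr_growth[where p = golden and c = c])
    fix B
    let ?X = "\<lambda>i. map_matrix of_int (x i) :: real^2^2"
    show "\<exists>i\<ge>1. B < matrix_norm (x i)"
    proof (rule ccontr)
      assume "\<not> ?thesis"
      then have le: "infnorm (?X i) \<le> B" if "i \<ge> 1" for i
        using that by (auto simp: matrix_norm_def not_less)
      have "norm (?X i) \<le> sqrt DIM(real^2^2) * B" if "i \<ge> 1" for i
        using norm_le_infnorm[of "?X i"] le[OF that]
        by (smt (verit) mult_left_mono real_sqrt_ge_zero of_nat_0_le_iff)
      then have "bounded (?X ` {1..})" unfolding bounded_iff by auto
      then show False using assms unfolding extremal_data_def by blast
    qed
  qed (use golden_gt_1 c in auto)
qed

lemma conjugate2_transpose: "conjugate2 \<xi> (transpose M) = conjugate1 \<xi> M"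
  by (simp add: conjugate1_def conjugate2_def transpose_def)

text \<open>As \<open>1\<close>, \<open>\<xi>\<close> and \<open>\<xi>\<^sup>2\<close> satisfy no non-trivial integer relation, a vanishing expression would have
  only zero coefficients. The fourth one is the common obstruction to
  coincidences among \<open>\<xi>\<close> and its two conjugates; it is non-zero because \<open>N\<close> is not skew-symmetric.\<close>

lemma extremal_nondegenerate:
  fixes N :: "int^2^2"
  assumes ext: "extremal \<xi>" and N: "N \<in> primitive_matrices" "transpose N \<noteq> N" "transpose N \<noteq> - N"
  defines "a \<equiv> real_of_int (N$1$1)" and "b \<equiv> real_of_int (N$1$2)"
    and "c \<equiv> real_of_int (N$2$1)" and "d \<equiv> real_of_int (N$2$2)"
  shows "b + d * \<xi> \<noteq> 0" "c + d * \<xi> \<noteq> 0" "a * d - b * c \<noteq> 0"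
    "a + (b + c) * \<xi> + d * \<xi>\<^sup>2 \<noteq> 0" "b \<noteq> c"
proof -
  have det: "N$1$1 * N$2$2 - N$1$2 * N$2$1 \<noteq> 0" using N(1) by (rule primitive_matricesD)
  have ns: "N$1$2 \<noteq> N$2$1" and nss: "\<not> (N$1$1 = 0 \<and> N$1$2 + N$2$1 = 0 \<and> N$2$2 = 0)"
    using N(2,3) by (auto simp: vec_eq_iff transpose_def forall_2)
  have rel: "u = 0 \<and> v = 0 \<and> w = 0" if "of_int u + of_int v * \<xi> + of_int w * \<xi>\<^sup>2 = 0" for u v w
    using quadratic_relation_trivial[OF _ _ that] ext unfolding extremal_def by blast
  show "b + d * \<xi> \<noteq> 0"
    using rel[of "N$1$2" "N$2$2" 0] det unfolding b_def d_def by auto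
  show "c + d * \<xi> \<noteq> 0"
    using rel[of "N$2$1" "N$2$2" 0] det unfolding c_def d_def by auto
  show "a * d - b * c \<noteq> 0"
    using det unfolding a_def b_def c_def d_def by (simp flip: of_int_mult of_int_diff)
  show "a + (b + c) * \<xi> + d * \<xi>\<^sup>2 \<noteq> 0"
    using rel[of "N$1$1" "N$1$2 + N$2$1" "N$2$2"] nss unfolding a_def b_def c_def d_def by auto
  show "b \<noteq> c" using ns unfolding b_def c_def by simp
qed

lemma conjugate1_neq_conjugate2:
  assumes ext: "extremal \<xi>" and M: "M \<in> primitive_matrices" "transpose M \<noteq> M" "transpose M \<noteq> - M"
  shows "conjugate1 \<xi> M \<noteq> conjugate2 \<xi> M"
proof
  define a b c d where abcd: "a = real_of_int (M$1$1)" "b = real_of_int (M$1$2)"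
    "c = real_of_int (M$2$1)" "d = real_of_int (M$2$2)"
  note nz = extremal_nondegenerate[OF assms, folded abcd]
  assume "conjugate1 \<xi> M = conjugate2 \<xi> M"
  then have "(a + b * \<xi>) * (b + d * \<xi>) = (a + c * \<xi>) * (c + d * \<xi>)"
    using nz(1,2) unfolding conjugate1_def conjugate2_def abcd[symmetric]
    by (simp add: frac_eq_eq) algebra
  then have "(b - c) * (a + (b + c) * \<xi> + d * \<xi>\<^sup>2) = 0" by algebra
  with nz show False by simp
qed

text \<open>Multiplied by the greatest common divisor \<open>k\<close> of the entries of \<open>x\<^sub>i N\<close>, the polynomial \<open>F\<^sub>i(1,T)\<close>
  is the product of the row \<open>(T, -1)\<close>, the matrix \<open>x\<^sub>i N\<close> and the column \<open>(1, T)\<close>. Its roots are \<open>\<alpha>\<^sub>i\<close> and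
  the conjugate of \<open>\<alpha>\<^sub>i\<close>.\<close>

lemma best_approximation_factor:
  fixes N :: "int^2^2" and z :: complex
  assumes best: "best_quadratic_approximations \<xi> x M i0 \<alpha>" and i: "i \<ge> i0"
    and N: "N = (if even i then M else transpose M)" and sym: "transpose (x i) = x i"
  shows "(z * of_int (x i$1$1) - of_int (x i$1$2)) * (of_int (N$1$1) + of_int (N$1$2) * z)
      + (z * of_int (x i$1$2) - of_int (x i$2$2)) * (of_int (N$2$1) + of_int (N$2$2) * z)
    = of_int (N$1$2 * x i$1$1 + N$2$2 * x i$1$2) * (z - \<alpha> i) * (z - quadratic_conjugate (\<alpha> i))"
proof -
  define W where "W = Wmat x M i"
  define k where "k = entries_gcd (x i ** N)"
  have alg: "algebraic (\<alpha> i)" "alg_degree (\<alpha> i) = 2"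
    and root: "poly (map_poly of_int (at_U_eq_1 (Fform x M i))) (\<alpha> i) = 0"
    using best i unfolding best_quadratic_approximations_def is_arg_min_def by auto
  have W: "W = x i \<star> N" by (simp add: W_def Wmat_def N)
  have x21: "x i$2$1 = x i$1$2" using sym by (rule symmetric_offdiag)
  have kW: "k * W$p$q = x i$p$1 * N$1$q + x i$p$2 * N$2$q" for p q
    unfolding W k_def entries_gcd_times_prim_mult by (simp add: matrix_matrix_mult_def sum_2)
  have r: "of_int (- W$2$1) + of_int (W$1$1 - W$2$2) * \<alpha> i + of_int (W$1$2) * (\<alpha> i)\<^sup>2 = 0"
    using root unfolding at_U_eq_1_Fform poly_map_of_int_quadratic W_def .
  have f: "of_int (- W$2$1) + of_int (W$1$1 - W$2$2) * z + of_int (W$1$2) * z\<^sup>2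
      = of_int (W$1$2) * (z - \<alpha> i) * (z - quadratic_conjugate (\<alpha> i))"
    by (rule poly_eq_quadratic_conjugate[OF alg r])
  have "(z * of_int (x i$1$1) - of_int (x i$1$2)) * (of_int (N$1$1) + of_int (N$1$2) * z)
      + (z * of_int (x i$1$2) - of_int (x i$2$2)) * (of_int (N$2$1) + of_int (N$2$2) * z)
    = of_int (- (k * W$2$1)) + of_int (k * W$1$1 - k * W$2$2) * z + of_int (k * W$1$2) * z\<^sup>2"
    unfolding kW x21 by (simp add: algebra_simps power2_eq_square)
  also have "\<dots> = of_int k * (of_int (- W$2$1) + of_int (W$1$1 - W$2$2) * z + of_int (W$1$2) * z\<^sup>2)"
    by (simp add: algebra_simps)
  also have "\<dots> = of_int (k * W$1$2) * (z - \<alpha> i) * (z - quadratic_conjugate (\<alpha> i))"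
    unfolding f by simp
  also have "k * W$1$2 = N$1$2 * x i$1$1 + N$2$2 * x i$1$2"
    unfolding kW by simp
  finally show ?thesis .
qed

text \<open>If equality held, then an integer quadratic relation for \<open>\<xi>\<close> would force \<open>N x\<^sub>i\<close> to be a scalar
  matrix, so that \<open>N\<close> would be symmetric like the inverse of \<open>x\<^sub>i\<close>.\<close>

lemma conjugate_not_attained:
  fixes N :: "int^2^2"
  assumes ext: "extremal \<xi>" and best: "best_quadratic_approximations \<xi> x M i0 \<alpha>" and i: "i \<ge> i0"
    and N: "N = (if even i then M else transpose M)"
    and prim: "N \<in> primitive_matrices" "transpose N \<noteq> N" "transpose N \<noteq> - N"
    and x: "transpose (x i) = x i" "x i \<in> primitive_matrices"
  shows "of_real (conjugate2 \<xi> N) \<noteq> quadratic_conjugate (\<alpha> i)"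
proof
  define A B C D x0 x1 x2 where abcd: "A = N$1$1" "B = N$1$2" "C = N$2$1" "D = N$2$2"
    and xs: "x0 = x i$1$1" "x1 = x i$1$2" "x2 = x i$2$2"
  define a b c d where re: "a = real_of_int A" "b = real_of_int B" "c = real_of_int C" "d = real_of_int D"
  note nz = extremal_nondegenerate[OF ext prim, folded abcd, folded re]
  have x21: "x i$2$1 = x i$1$2" using x(1) by (rule symmetric_offdiag)
  have det: "x0 * x2 - x1 * x1 \<noteq> 0"
    using primitive_matricesD[OF x(2)] by (simp add: xs x21)
  define t where "t = conjugate2 \<xi> N"
  have t: "t * (b + d * \<xi>) = - (a + c * \<xi>)"
    using nz(1) by (simp add: t_def conjugate2_def abcd[symmetric] re[symmetric])
  assume "of_real (conjugate2 \<xi> N) = quadratic_conjugate (\<alpha> i)"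
  then have "of_real ((t * x0 - x1) * (a + b * t) + (t * x1 - x2) * (c + d * t)) = (0 :: complex)"
    using best_approximation_factor[OF best i N x(1), of "of_real t"]
    by (simp add: t_def[symmetric] abcd[symmetric] xs[symmetric] re)
  then have v: "(t * x0 - x1) * (a + b * t) + (t * x1 - x2) * (c + d * t) = 0"
    by (simp only: of_real_eq_0_iff)
  \<comment> \<open>Clearing the denominator \<open>b + d\<xi>\<close> of \<open>t\<close> leaves the factor \<open>det N\<close>.\<close>
  have "(a * d - b * c) * ((of_int (A * x1 + B * x2)
      + of_int (- A * x0 + C * x1 - B * x1 + D * x2) * \<xi> + of_int (- C * x0 - D * x1) * \<xi>\<^sup>2))
    = (b + d * \<xi>)\<^sup>2 * ((t * x0 - x1) * (a + b * t) + (t * x1 - x2) * (c + d * t))"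
    using t unfolding of_int_add of_int_diff of_int_mult of_int_minus re[symmetric] by algebra
  with v nz have "of_int (A * x1 + B * x2)
      + of_int (- A * x0 + C * x1 - B * x1 + D * x2) * \<xi> + of_int (- C * x0 - D * x1) * \<xi>\<^sup>2 = 0"
    by simp
  then have "A * x1 + B * x2 = 0" "- A * x0 + C * x1 - B * x1 + D * x2 = 0" "- C * x0 - D * x1 = 0"
    using quadratic_relation_trivial ext unfolding extremal_def by blast+
  then have "(B - C) * (x0 * x2 - x1 * x1) = 0" by algebra
  with det nz(5) show False by (simp add: re)
qed

text \<open>Both parities at once: along the indices \<open>r n\<close> of one parity the matrix \<open>M\<^sub>i\<close> is a fixed \<open>N\<close>, equal to
  \<open>M\<close> or to its transpose, and the conjugates of the approximations tend to \<open>conjugate2 \<xi> N\<close>.\<close>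

lemma conjugate_distance:
  fixes N :: "int^2^2" and r :: "nat \<Rightarrow> nat"
  assumes ext: "extremal \<xi>" and data: "extremal_data \<xi> x M"
    and best: "best_quadratic_approximations \<xi> x M i0 \<alpha>"
    and r: "filterlim r at_top sequentially"
    and N: "\<And>n. i0 \<le> r n \<Longrightarrow> N = (if even (r n) then M else transpose M)"
  shows "comparable_on {n. i0 \<le> r n}
      (\<lambda>n. cmod (of_real (conjugate2 \<xi> N) - quadratic_conjugate (\<alpha> (r n))))
      (\<lambda>n. height (\<alpha> (r n)) powr (- 2))"
    and "(\<lambda>n. quadratic_conjugate (\<alpha> (r n))) \<longlonglongrightarrow> of_real (conjugate2 \<xi> N)"
proof -
  have i0: "i0 \<ge> 1" using best by (simp add: best_quadratic_approximations_def)
  have r_ge: "eventually (\<lambda>n. r n \<in> {i0..}) sequentially"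
    using r by (simp add: filterlim_at_top)
  then obtain n0 where "i0 \<le> r n0" by (auto simp: eventually_sequentially)
  from N[OF this] have "N = M \<or> N = transpose M" by presburger
  then have prim: "N \<in> primitive_matrices" "transpose N \<noteq> N" "transpose N \<noteq> - N"
    using data transpose_primitive_matrices unfolding extremal_data_def
    by (auto simp: transpose_transpose) (metis minus_minus transpose_transpose)+
  define X where "X = (\<lambda>n. matrix_norm (x (r n)))"
  define dist where "dist = (\<lambda>n. cmod (of_real (conjugate2 \<xi> N) - quadratic_conjugate (\<alpha> (r n))))"
  define H where "H = (\<lambda>n. height (\<alpha> (r n)))"
  have xi: "transpose (x i) = x i" "x i \<in> primitive_matrices" if "i \<ge> i0" for i
    using data that i0 unfolding extremal_data_def by auto
  have Xpos: "0 < matrix_norm (x i)" if "i \<ge> i0" for i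
    using extremal_data_matrix_norm(1)[OF data] that i0 by simp
  have X_top: "filterlim X at_top sequentially"
    unfolding X_def by (rule filterlim_compose[OF extremal_data_matrix_norm(2)[OF data] r])
  have Fpos: "0 < bipoly_norm (Fform x M i)" and Hpos: "0 < height (\<alpha> i)" if "i \<ge> i0" for i
  proof -
    have HF: "comparable_on {i0..} (\<lambda>i. height (\<alpha> i)) (\<lambda>i. bipoly_norm (Fform x M i))"
      and FX: "comparable_on {i0..} (\<lambda>i. bipoly_norm (Fform x M i)) (\<lambda>i. matrix_norm (x i))"
      using best by (auto simp: best_quadratic_approximations_def)
    show F: "0 < bipoly_norm (Fform x M i)"
      using comparable_on_pos[OF FX _ Xpos[OF that]] that by simp
    show "0 < height (\<alpha> i)"
      using comparable_on_pos[OF HF _ F] that by simp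
  qed
  have "H \<in> \<Theta>(\<lambda>n. bipoly_norm (Fform x M (r n)))"
    unfolding H_def by (rule comparable_on_imp_bigtheta[OF _ _ r_ge])
      (use best Fpos in \<open>auto simp: best_quadratic_approximations_def intro: less_imp_le\<close>)
  also have "(\<lambda>n. bipoly_norm (Fform x M (r n))) \<in> \<Theta>(X)"
    unfolding X_def by (rule comparable_on_imp_bigtheta[OF _ _ r_ge])
      (use best Xpos in \<open>auto simp: best_quadratic_approximations_def intro: less_imp_le\<close>)
  finally have HX: "H \<in> \<Theta>(X)" .
  have ev: "eventually (\<lambda>n. i0 \<le> r n \<and> 1 \<le> X n) sequentially"
    using eventually_conj[OF r_ge filterlim_at_top[THEN iffD1, OF X_top, rule_format, of 1]] by simp
  have H_powr: "(\<lambda>n. H n powr p) \<in> \<Theta>(\<lambda>n. X n powr p)" for p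
  proof -
    have "eventually (\<lambda>n. H n powr p = \<bar>H n\<bar> powr p) sequentially"
      using ev by eventually_elim (use Hpos in \<open>simp add: H_def less_imp_le\<close>)
    moreover have "eventually (\<lambda>n. X n powr p = \<bar>X n\<bar> powr p) sequentially"
      using ev by eventually_elim simp
    ultimately show ?thesis
      using bigtheta_powr[OF HX, of p] by (simp only: landau_theta.in_cong landau_theta.cong)
  qed
  have X2: "eventually (\<lambda>n. X n powr (- 2) = 1 / (X n)\<^sup>2) sequentially"
    using ev by eventually_elim (simp add: powr_minus_divide powr_numeral)

  have "dist \<in> \<Theta>(\<lambda>n. 1 / (X n)\<^sup>2)"
  proof -
    define a b c d where abcd: "a = real_of_int (N$1$1)" "b = real_of_int (N$1$2)"
      "c = real_of_int (N$2$1)" "d = real_of_int (N$2$2)"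
    have x21: "x i$2$1 = x i$1$2" if "i \<ge> i0" for i
      using xi(1)[OF that] by (rule symmetric_offdiag)
    have "(\<lambda>n. cmod (of_real (- (a + c * \<xi>) / (b + d * \<xi>)) - quadratic_conjugate (\<alpha> (r n)))) \<in> \<Theta>(\<lambda>n. 1 / (X n)\<^sup>2)"
    proof (rule conjugate_root_asymptotics[OF X_top, where \<alpha> = "\<lambda>n. \<alpha> (r n)"])
      show "eventually (\<lambda>n. X n = max \<bar>real_of_int (x (r n)$1$1)\<bar>
          (max \<bar>real_of_int (x (r n)$1$2)\<bar> \<bar>real_of_int (x (r n)$2$2)\<bar>)) sequentially"
        using ev by eventually_elim (simp add: X_def matrix_norm_2 x21 max.assoc max.left_idem)
      have "(\<lambda>n. infnorm (vector [\<xi>, - 1] v* (map_matrix of_int (x (r n)) :: real^2^2)))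
          \<in> \<Theta>(\<lambda>n. matrix_norm (x (r n)) powr (- 1))"
        by (rule comparable_on_imp_bigtheta[where I = "{1..}"])
          (use data r_ge i0 in \<open>auto simp: extremal_data_def elim!: eventually_mono\<close>)
      moreover have "eventually (\<lambda>n. infnorm (vector [\<xi>, - 1] v* (map_matrix of_int (x (r n)) :: real^2^2))
          = max \<bar>real_of_int (x (r n)$1$1) * \<xi> - real_of_int (x (r n)$1$2)\<bar>
              \<bar>real_of_int (x (r n)$1$2) * \<xi> - real_of_int (x (r n)$2$2)\<bar>) sequentially"
        using ev by eventually_elim (simp add: infnorm_row_times_matrix x21)
      moreover have "eventually (\<lambda>n. matrix_norm (x (r n)) powr (- 1) = 1 / X n) sequentially"
        using ev by eventually_elim (simp add: X_def powr_minus_divide)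
      ultimately show "(\<lambda>n. max \<bar>real_of_int (x (r n)$1$1) * \<xi> - real_of_int (x (r n)$1$2)\<bar>
              \<bar>real_of_int (x (r n)$1$2) * \<xi> - real_of_int (x (r n)$2$2)\<bar>) \<in> \<Theta>(\<lambda>n. 1 / X n)"
        by (simp only: landau_theta.in_cong landau_theta.cong)
      have "(\<lambda>n. cmod (of_real \<xi> - \<alpha> (r n))) \<in> \<Theta>(\<lambda>n. H n powr (- 2 * golden - 2))"
        unfolding H_def by (rule comparable_on_imp_bigtheta[OF _ _ r_ge])
          (use best in \<open>auto simp: best_quadratic_approximations_def\<close>)
      also have "(\<lambda>n. H n powr (- 2 * golden - 2)) \<in> \<Theta>(\<lambda>n. X n powr (- 2 * golden - 2))"
        by (rule H_powr)
      also have "(\<lambda>n. X n powr (- 2 * golden - 2)) \<in> o(\<lambda>n. X n powr (- 2))"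
        using X_top golden_gt_1 by (subst powr_smallo_iff) auto
      finally show "(\<lambda>n. cmod (of_real \<xi> - \<alpha> (r n))) \<in> o(\<lambda>n. 1 / (X n)\<^sup>2)"
        by (simp only: landau_o.small.cong[OF X2])
      show "eventually (\<lambda>n. \<forall>z.
        (z * of_real (real_of_int (x (r n)$1$1)) - of_real (real_of_int (x (r n)$1$2))) * (of_real a + of_real b * z)
        + (z * of_real (real_of_int (x (r n)$1$2)) - of_real (real_of_int (x (r n)$2$2))) * (of_real c + of_real d * z)
        = of_real (b * real_of_int (x (r n)$1$1) + d * real_of_int (x (r n)$1$2))
          * (z - \<alpha> (r n)) * (z - quadratic_conjugate (\<alpha> (r n)))) sequentially"
        using ev
      proof eventually_elim
        case (elim n)
        then have n: "i0 \<le> r n" by simp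
        show ?case
          using best_approximation_factor[OF best n N[OF n] xi(1)[OF n]] unfolding abcd by simp
      qed
    qed (use extremal_nondegenerate[OF ext prim] abcd in auto)
    then show ?thesis by (simp add: dist_def conjugate2_def abcd)
  qed
  then have dist_X: "dist \<in> \<Theta>(\<lambda>n. X n powr (- 2))"
    by (simp only: landau_theta.cong[OF X2])
  then have "dist \<in> \<Theta>(\<lambda>n. H n powr (- 2))"
    using H_powr[of "- 2"] by (metis bigtheta_sym landau_theta.cong_bigtheta)
  then have "comparable_on {n. i0 \<le> r n} dist (\<lambda>n. H n powr (- 2))"
  proof (rule bigtheta_imp_comparable_on)
    fix n assume "n \<in> {n. i0 \<le> r n}"
    then have n: "i0 \<le> r n" by simp
    show "0 < dist n"
      using conjugate_not_attained[OF ext best n N[OF n] prim xi[OF n]] by (simp add: dist_def)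
    show "0 < H n powr (- 2)" using Hpos[OF n] by (simp add: H_def)
  qed
  then show "comparable_on {n. i0 \<le> r n}
      (\<lambda>n. cmod (of_real (conjugate2 \<xi> N) - quadratic_conjugate (\<alpha> (r n))))
      (\<lambda>n. height (\<alpha> (r n)) powr (- 2))"
    by (simp add: dist_def H_def)
  have "(\<lambda>n. X n powr (- 2)) \<in> o(\<lambda>n. X n powr 0)"
    using X_top by (subst powr_smallo_iff) auto
  also have "(\<lambda>n. X n powr 0) \<in> O(\<lambda>_. 1)" by (intro bigoI[of _ 1]) auto
  finally have "dist \<in> o(\<lambda>_. 1)"
    using dist_X by (metis bigthetaD1 landau_o.big_small_trans)
  then have "dist \<longlonglongrightarrow> 0" by (rule smalloD_tendsto[of _ _ "\<lambda>_. 1", simplified])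
  then show "(\<lambda>n. quadratic_conjugate (\<alpha> (r n))) \<longlonglongrightarrow> of_real (conjugate2 \<xi> N)"
    unfolding dist_def
    by (subst tendsto_dist_iff) (simp add: dist_norm norm_minus_commute)
qed

theorem proposition4p9:
  fixes \<xi> :: real and x :: "nat \<Rightarrow> int^2^2" and M :: "int^2^2"
    and i0 :: nat and \<alpha> :: "nat \<Rightarrow> complex"
  assumes "extremal \<xi>"
    and "extremal_data \<xi> x M"
    and "best_quadratic_approximations \<xi> x M i0 \<alpha>"
  shows
    "comparable_on {i. i0 \<le> 2 * i - 1}
       (\<lambda>i. cmod (of_real (conjugate1 \<xi> M) - quadratic_conjugate (\<alpha> (2 * i - 1))))
       (\<lambda>i. height (\<alpha> (2 * i - 1)) powr (- 2)) \<and>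
     comparable_on {i. i0 \<le> 2 * i}
       (\<lambda>i. cmod (of_real (conjugate2 \<xi> M) - quadratic_conjugate (\<alpha> (2 * i))))
       (\<lambda>i. height (\<alpha> (2 * i)) powr (- 2)) \<and>
     conjugate1 \<xi> M \<noteq> conjugate2 \<xi> M \<and>
     accumulation_points (\<lambda>i. quadratic_conjugate (\<alpha> i))
       = {of_real (conjugate1 \<xi> M), of_real (conjugate2 \<xi> M)}"
proof -
  have i0: "i0 \<ge> 1" using assms(3) by (simp add: best_quadratic_approximations_def)
  have lim_odd: "filterlim (\<lambda>n::nat. 2 * n - 1) at_top sequentially"
    by (rule filterlim_at_top_mono[OF filterlim_ident]) (auto simp: eventually_sequentially intro!: exI[of _ 1])
  have lim_even: "filterlim (\<lambda>n::nat. 2 * n) at_top sequentially"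
    by (rule filterlim_at_top_mono[OF filterlim_ident]) auto
  \<comment> \<open>For \<open>n = 0\<close> the index \<open>2 * n - 1\<close> is \<open>0\<close>, which lies below \<open>i0\<close>.\<close>
  have par: "odd (2 * n - 1)" if "i0 \<le> 2 * n - 1" for n :: nat
    using that i0 by (cases n) auto
  have N_odd: "transpose M = (if even (2 * n - 1) then M else transpose M)" if "i0 \<le> 2 * n - 1" for n :: nat
    using par[OF that] by simp
  have N_even: "M = (if even (2 * n) then M else transpose M)" for n :: nat
    by simp
  note odd = conjugate_distance[OF assms lim_odd N_odd, unfolded conjugate2_transpose]
  note even = conjugate_distance[OF assms lim_even N_even]
  have "accumulation_points (\<lambda>i. quadratic_conjugate (\<alpha> i))
       = {of_real (conjugate1 \<xi> M), of_real (conjugate2 \<xi> M)}"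
    by (rule accumulation_points_two_limits[OF odd(2) even(2)])
  moreover have "conjugate1 \<xi> M \<noteq> conjugate2 \<xi> M"
    using assms(2) by (intro conjugate1_neq_conjugate2[OF assms(1)]) (auto simp: extremal_data_def)
  ultimately show ?thesis
    using odd(1) even(1) by blast
qed

end
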